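(* Let $f(z)=\sum_{k=0}^{\infty}a_{2k+1}z^{2k+1}+\sum_{k=0}^{\infty}\overline{b_{2k+1}z^{2k+1}}$ be an odd harmonic function in $\mathbb{D}$ such that $|f(z)|<1$ for all $z\in\mathbb{D}$. Then for every real $p\in[1,2]$, $$\sum_{k=0}^{\infty}\left(|a_{2k+1}|^p+|b_{2k+1}|^p\right)^{1/p}r^{2k+1}\le 2^{(1/p)-1/2}\frac{r}{\sqrt{1-r^4}}\le 1\quad\text{for } 0\le r\le\rho_p,$$ where $\rho_p=\sqrt{\sqrt{4^{(2/p)-2}+1}-2^{(2/p)-2}}$. For every real $p\ge 2$, $$\sum_{k=0}^{\infty}\left(|a_{2k+1}|^p+|b_{2k+1}|^p\right)^{1/p}r^{2k+1}\le \frac{r}{\sqrt{1-r^4}}\le 1\quad\text{for } 0\le r\le\rho_2=\sqrt{\frac{\sqrt5-1}{2}}.$$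
   Context: $\mathbb{D}=\{z\in\mathbb{C}:|z|<1\}$ is the open unit disk. Harmonic functions are complex-valued; the series $\sum a_{2k+1}z^{2k+1}$ and $\sum b_{2k+1}z^{2k+1}$ are analytic in $\mathbb{D}$. *)

theory Defs
  imports "HOL-Analysis.Analysis"
begin

text \<open>
  Complex-valued harmonic functions on an open set: twice continuously differentiable
  in the real sense with vanishing Laplacian. The witnesses \<open>fx\<close>, \<open>fy\<close>, \<open>fxx\<close>, ... are
  the partial derivatives with respect to \<open>Re z\<close> and \<open>Im z\<close>.
\<close>

definition harmonic_on :: "(complex \<Rightarrow> complex) \<Rightarrow> complex set \<Rightarrow> bool" where
  "harmonic_on f S \<longleftrightarrow> open S \<and>
     (\<exists>fx fy fxx fxy fyx fyy.
        (\<forall>z\<in>S. (f has_derivative (\<lambda>h. Re h *\<^sub>R fx z + Im h *\<^sub>R fy z)) (at z)) \<and>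
        (\<forall>z\<in>S. (fx has_derivative (\<lambda>h. Re h *\<^sub>R fxx z + Im h *\<^sub>R fxy z)) (at z)) \<and>
        (\<forall>z\<in>S. (fy has_derivative (\<lambda>h. Re h *\<^sub>R fyx z + Im h *\<^sub>R fyy z)) (at z)) \<and>
        continuous_on S fxx \<and> continuous_on S fxy \<and>
        continuous_on S fyx \<and> continuous_on S fyy \<and>
        (\<forall>z\<in>S. fxx z + fyy z = 0))"

definition rho :: "real \<Rightarrow> real" where
  "rho p = sqrt (sqrt (4 powr (2 / p - 2) + 1) - 2 powr (2 / p - 2))"

end

theory Submission
  imports Defs
begin

text \<open>
  Writing \<open>c\<^sub>k = sqrt (|a\<^sub>2\<^sub>k\<^sub>+\<^sub>1|\<^sup>2 + |b\<^sub>2\<^sub>k\<^sub>+\<^sub>1|\<^sup>2)\<close>, the whole theorem rests on the inequality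
  \<open>\<Sum>\<^sub>k c\<^sub>k\<^sup>2 \<le> 1\<close>, which is Parseval's identity for \<open>f\<close> on the circles of radius \<open>s < 1\<close>, followed
  by \<open>s \<rightarrow> 1\<close>. The mean of \<open>|f|\<^sup>2\<close> is taken over finitely many equally spaced points instead of over
  the circle: at \<open>z = s u\<close> with \<open>|u| = 1\<close>, a truncation of \<open>f\<close> is, up to a factor of modulus one, a
  polynomial in \<open>u\<^sup>2\<close> of degree less than the number of points, so the discrete mean of its squared modulus is exactly the sum of
  the squared coefficients (\<open>discrete_parseval\<close>), while the truncation error tends to zero
  uniformly on the circle (\<open>coefficient_square_sum_le_1\<close>).

  The Cauchy-Schwarz inequality then gives
  \<open>\<Sum>\<^sub>k c\<^sub>k r\<^sup>2\<^sup>k\<^sup>+\<^sup>1 \<le> sqrt (\<Sum>\<^sub>k r\<^sup>4\<^sup>k\<^sup>+\<^sup>2) = r / sqrt (1 - r\<^sup>4)\<close>. Passing from \<open>p = 2\<close> to other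
  exponents is a comparison of norms on the plane: the \<open>p\<close>-norm is at most the
  Euclidean norm for \<open>p \<ge> 2\<close>, and at most \<open>2\<^sup>1\<^sup>/\<^sup>p\<^sup>-\<^sup>1\<^sup>/\<^sup>2\<close> times the Euclidean norm for \<open>p \<le> 2\<close>.
  Finally, with \<open>K = 2\<^sup>1\<^sup>/\<^sup>p\<^sup>-\<^sup>1\<^sup>/\<^sup>2\<close>, the condition \<open>K r / sqrt (1 - r\<^sup>4) \<le> 1\<close> is a quadratic inequality
  in \<open>r\<^sup>2\<close>, and its positive root is the square of \<open>rho p\<close>.
\<close>

section \<open>Square sums of the coefficients\<close>

text \<open>
  Expanding the square reduces the identity to orthogonality of the characters \<open>m \<mapsto> \<zeta>\<^sub>j\<^sup>m\<close>,
  a geometric sum whose ratio \<open>\<zeta>\<^sub>j \<zeta>\<^sub>l\<^sup>-\<^sup>1\<close> is an \<open>n\<close>-th root of unity.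
\<close>

lemma discrete_parseval:
  fixes c :: "nat \<Rightarrow> complex" and n :: nat
  defines "\<zeta> \<equiv> \<lambda>j. cis (2 * pi * real j / real n)"
  assumes n: "n > 0"
  shows "(\<Sum>m<n. (norm (\<Sum>j<n. c j * \<zeta> j ^ m))\<^sup>2) = real n * (\<Sum>j<n. (norm (c j))\<^sup>2)"
proof -
  have bij: "bij_betw \<zeta> {..<n} {z. z ^ n = 1}"
    unfolding \<zeta>_def by (rule Complex.bij_betw_roots_unity[OF n])
  have root: "\<zeta> j ^ n = 1" if "j < n" for j
    using bij that by (auto simp: bij_betw_def)
  have unit: "\<zeta> j * cnj (\<zeta> j) = 1" for j
    by (simp add: \<zeta>_def complex_norm_square[symmetric])
  have orth: "(\<Sum>m<n. (\<zeta> j * cnj (\<zeta> l)) ^ m) = (if j = l then of_nat n else 0)"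
    if jl: "j < n" "l < n" for j l
  proof (cases "j = l")
    case True
    then show ?thesis by (simp add: unit)
  next
    case False
    have ne: "\<zeta> j * cnj (\<zeta> l) \<noteq> 1"
    proof
      assume "\<zeta> j * cnj (\<zeta> l) = 1"
      then have "\<zeta> j = \<zeta> l"
        using unit[of l] by (metis mult.assoc mult.commute mult.right_neutral)
      then show False
        using bij jl False by (auto simp: bij_betw_def inj_on_def)
    qed
    have "(\<zeta> j * cnj (\<zeta> l)) ^ n = 1"
      using root jl by (simp add: power_mult_distrib flip: complex_cnj_power)
    then show ?thesis using False geometric_sum[OF ne] by simp
  qed
  have "complex_of_real (\<Sum>m<n. (norm (\<Sum>j<n. c j * \<zeta> j ^ m))\<^sup>2)
      = (\<Sum>m<n. \<Sum>j<n. \<Sum>l<n. c j * cnj (c l) * (\<zeta> j * cnj (\<zeta> l)) ^ m)"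
    by (simp add: complex_norm_square sum_product power_mult_distrib mult_ac del: of_real_power)
  also have "\<dots> = (\<Sum>j<n. \<Sum>l<n. c j * cnj (c l) * (\<Sum>m<n. (\<zeta> j * cnj (\<zeta> l)) ^ m))"
    by (subst sum.swap, rule sum.cong[OF refl], subst sum.swap) (simp add: sum_distrib_left)
  also have "\<dots> = (\<Sum>j<n. \<Sum>l<n. if j = l then c j * cnj (c l) * of_nat n else 0)"
    by (intro sum.cong) (auto simp: orth)
  also have "\<dots> = (\<Sum>j<n. c j * cnj (c j) * of_nat n)"
    by simp
  also have "\<dots> = complex_of_real (real n * (\<Sum>j<n. (norm (c j))\<^sup>2))"
    by (simp add: complex_norm_square sum_distrib_left mult_ac del: of_real_power)
  finally show ?thesis by (simp only: of_real_eq_iff)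
qed

lemma sum_lessThan_add_split:
  fixes g :: "nat \<Rightarrow> 'a::comm_monoid_add"
  shows "(\<Sum>j<m + n. g j) = (\<Sum>j<m. g j) + (\<Sum>j<n. g (m + j))"
  by (induction n) (auto simp: add.assoc)

text \<open>
  The frequencies \<open>-(2n-1), \<dots>, -1, 1, \<dots>, 2n-1\<close> are equally spaced, so multiplication by
  \<open>u\<^sup>2\<^sup>n\<^sup>-\<^sup>1\<close> turns the trigonometric polynomial into a polynomial in \<open>u\<^sup>2\<close> of degree less than \<open>2n\<close>,
  whose squared coefficients are recovered from the \<open>2n\<close> points \<open>u\<close> in a half circle for which
  \<open>u\<^sup>2\<close> runs through the \<open>2n\<close>-th roots of unity.
\<close>

lemma odd_trig_polynomial_square_sum_le:
  fixes \<alpha> \<beta> :: "nat \<Rightarrow> complex"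
  assumes bd: "\<And>u. norm u = 1 \<Longrightarrow>
    norm (\<Sum>k<n. \<alpha> k * u ^ (2 * k + 1) + cnj (\<beta> k * u ^ (2 * k + 1))) \<le> B"
  shows "(\<Sum>k<n. (norm (\<alpha> k))\<^sup>2 + (norm (\<beta> k))\<^sup>2) \<le> B\<^sup>2"
proof (cases "n = 0")
  case True
  then show ?thesis by simp
next
  case False
  define c where "c j = (if j < n then cnj (\<beta> (n - Suc j)) else \<alpha> (j - n))" for j
  define u where "u m = cis (pi * real m / real (n + n))" for m
  define S where
    "S v = (\<Sum>k<n. \<alpha> k * v ^ (2 * k + 1) + cnj (\<beta> k * v ^ (2 * k + 1)))" for v :: complex
  have poly: "(\<Sum>j<n + n. c j * v ^ (2 * j)) = v ^ (2 * n - 1) * S v" if v: "norm v = 1" for v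
  proof -
    have vv: "v * cnj v = 1" using v by (simp add: complex_norm_square[symmetric])
    have "(\<Sum>j<n. c j * v ^ (2 * j)) = (\<Sum>k<n. c (n - Suc k) * v ^ (2 * (n - Suc k)))"
      by (rule sum.nat_diff_reindex[symmetric])
    also have "\<dots> = (\<Sum>k<n. v ^ (2 * n - 1) * cnj (\<beta> k * v ^ (2 * k + 1)))"
    proof (rule sum.cong[OF refl])
      fix k assume "k \<in> {..<n}"
      then have k: "k < n" by simp
      have e: "2 * n - 1 = 2 * (n - Suc k) + (2 * k + 1)" using k by simp
      have "v ^ (2 * n - 1) * cnj v ^ (2 * k + 1)
          = v ^ (2 * (n - Suc k)) * (v * cnj v) ^ (2 * k + 1)"
        by (subst e) (simp only: power_add[of v "2 * (n - Suc k)"] power_mult_distrib mult.assoc)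
      then have "v ^ (2 * n - 1) * cnj v ^ (2 * k + 1) = v ^ (2 * (n - Suc k))"
        by (simp add: vv)
      moreover have "c (n - Suc k) = cnj (\<beta> k)" using k by (simp add: c_def)
      ultimately show "c (n - Suc k) * v ^ (2 * (n - Suc k))
          = v ^ (2 * n - 1) * cnj (\<beta> k * v ^ (2 * k + 1))"
        by (simp only: complex_cnj_mult complex_cnj_power mult.left_commute)
    qed
    finally have neg: "(\<Sum>j<n. c j * v ^ (2 * j))
        = (\<Sum>k<n. v ^ (2 * n - 1) * cnj (\<beta> k * v ^ (2 * k + 1)))" .
    have pos: "(\<Sum>k<n. c (n + k) * v ^ (2 * (n + k)))
        = (\<Sum>k<n. v ^ (2 * n - 1) * (\<alpha> k * v ^ (2 * k + 1)))"
    proof (rule sum.cong[OF refl])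
      fix k
      have e: "2 * (n + k) = (2 * n - 1) + (2 * k + 1)" using False by simp
      show "c (n + k) * v ^ (2 * (n + k)) = v ^ (2 * n - 1) * (\<alpha> k * v ^ (2 * k + 1))"
        by (simp only: e power_add[of v "2 * n - 1"]) (simp add: c_def mult_ac)
    qed
    show ?thesis
      unfolding sum_lessThan_add_split neg pos S_def
      by (simp add: sum_distrib_left sum.distrib distrib_left)
  qed
  have unit: "norm (u m) = 1" for m by (simp add: u_def)
  have pw: "cis (2 * pi * real j / real (n + n)) ^ m = u m ^ (2 * j)" for j m
    unfolding u_def Complex.DeMoivre by (simp add: field_simps)
  have coeffs: "(\<Sum>j<n + n. (norm (c j))\<^sup>2) = (\<Sum>k<n. (norm (\<alpha> k))\<^sup>2 + (norm (\<beta> k))\<^sup>2)"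
  proof -
    have "(\<Sum>j<n. (norm (c j))\<^sup>2) = (\<Sum>k<n. (norm (c (n - Suc k)))\<^sup>2)"
      by (rule sum.nat_diff_reindex[symmetric])
    also have "\<dots> = (\<Sum>k<n. (norm (\<beta> k))\<^sup>2)"
      by (intro sum.cong) (auto simp: c_def)
    finally show ?thesis
      unfolding sum_lessThan_add_split sum.distrib by (simp add: c_def)
  qed
  have "real (n + n) * (\<Sum>k<n. (norm (\<alpha> k))\<^sup>2 + (norm (\<beta> k))\<^sup>2)
      = (\<Sum>m<n + n. (norm (\<Sum>j<n + n. c j * u m ^ (2 * j)))\<^sup>2)"
    using discrete_parseval[of "n + n" c] False by (simp only: pw coeffs)
  also have "\<dots> = (\<Sum>m<n + n. (norm (S (u m)))\<^sup>2)"
    by (simp add: poly unit norm_mult norm_power)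
  also have "\<dots> \<le> (\<Sum>m<n + n. B\<^sup>2)"
    using bd unit unfolding S_def by (intro sum_mono power_mono) auto
  finally show ?thesis using False by simp
qed

text \<open>
  Convergence in the whole disk gives absolute convergence at every point, through the power series
  in \<open>z\<^sup>2\<close> obtained by cancelling one factor \<open>z\<close>.
\<close>

lemma odd_power_series_abs_summable:
  fixes \<alpha> :: "nat \<Rightarrow> complex"
  assumes sm: "\<And>z. z \<in> ball 0 1 \<Longrightarrow> summable (\<lambda>k. \<alpha> k * z ^ (2 * k + 1))"
    and s: "0 \<le> s" "s < 1"
  shows "summable (\<lambda>k. norm (\<alpha> k) * s ^ (2 * k + 1))"
proof -
  define t where "t = (1 + s) / 2"
  have t: "0 < t" "s < t" "t < 1" using s by (auto simp: t_def)
  have "summable (\<lambda>k. \<alpha> k * of_real t ^ (2 * k + 1) / of_real t)"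
    using t by (intro summable_divide sm) auto
  then have "summable (\<lambda>k. \<alpha> k * (of_real (t\<^sup>2)) ^ k)"
    using t by (simp add: power_mult)
  moreover have "norm (of_real (s\<^sup>2) :: complex) < norm (of_real (t\<^sup>2) :: complex)"
    using s t by (simp add: power_strict_mono norm_power)
  ultimately have "summable (\<lambda>k. norm (\<alpha> k * of_real (s\<^sup>2) ^ k))"
    by (rule powser_insidea)
  then have "summable (\<lambda>k. s * norm (\<alpha> k * of_real (s\<^sup>2) ^ k))"
    by (rule summable_mult)
  moreover have "s * norm (\<alpha> k * of_real (s\<^sup>2) ^ k) = norm (\<alpha> k) * s ^ (2 * k + 1)" for k
    using s by (simp add: norm_mult norm_power power_mult)
  ultimately show ?thesis by (simp only:)
qed

text \<open>
  On the circle of radius \<open>s\<close> the \<open>n\<close>-th truncation differs from the function by at most the tail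
  \<open>T n\<close> of \<open>\<Sum>\<^sub>k (|\<alpha>\<^sub>k| + |\<beta>\<^sub>k|) s\<^sup>2\<^sup>k\<^sup>+\<^sup>1\<close>, hence is bounded by \<open>1 + T n\<close> with \<open>T n \<rightarrow> 0\<close>.
\<close>

lemma coefficient_square_sum_le_1:
  fixes \<alpha> \<beta> :: "nat \<Rightarrow> complex"
  assumes sa: "\<And>z. z \<in> ball 0 1 \<Longrightarrow> summable (\<lambda>k. \<alpha> k * z ^ (2 * k + 1))"
    and sb: "\<And>z. z \<in> ball 0 1 \<Longrightarrow> summable (\<lambda>k. \<beta> k * z ^ (2 * k + 1))"
    and bd: "\<And>z. z \<in> ball 0 1 \<Longrightarrow>
      norm ((\<Sum>k. \<alpha> k * z ^ (2 * k + 1)) + (\<Sum>k. cnj (\<beta> k * z ^ (2 * k + 1)))) \<le> 1"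
  shows "(\<Sum>k<N. (norm (\<alpha> k))\<^sup>2 + (norm (\<beta> k))\<^sup>2) \<le> 1"
proof -
  have circle: "(\<Sum>k<N. ((norm (\<alpha> k))\<^sup>2 + (norm (\<beta> k))\<^sup>2) * (s ^ (2 * k + 1))\<^sup>2) \<le> 1"
    if s: "0 \<le> s" "s < 1" for s :: real
  proof -
    define g where "g k = norm (\<alpha> k) * s ^ (2 * k + 1) + norm (\<beta> k) * s ^ (2 * k + 1)" for k
    define T where "T n = (\<Sum>k. g (k + n))" for n
    have g: "summable g"
      unfolding g_def
      by (intro summable_add odd_power_series_abs_summable sa sb) (use s in auto)
    have T: "T \<longlonglongrightarrow> 0"
      unfolding T_def by (rule suminf_exist_split2[OF g])
    have trunc: "(\<Sum>k<n. ((norm (\<alpha> k))\<^sup>2 + (norm (\<beta> k))\<^sup>2) * (s ^ (2 * k + 1))\<^sup>2) \<le> (1 + T n)\<^sup>2" for n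
    proof -
      have "norm (\<Sum>k<n. (\<alpha> k * of_real (s ^ (2 * k + 1))) * u ^ (2 * k + 1)
            + cnj (\<beta> k * of_real (s ^ (2 * k + 1)) * u ^ (2 * k + 1))) \<le> 1 + T n"
        if u: "norm u = 1" for u :: complex
      proof -
        define z where "z = of_real s * u"
        have z: "z \<in> ball 0 1" "norm z = s" using s u by (auto simp: z_def norm_mult)
        define h where "h k = \<alpha> k * z ^ (2 * k + 1) + cnj (\<beta> k * z ^ (2 * k + 1))" for k
        have sc: "summable (\<lambda>k. cnj (\<beta> k * z ^ (2 * k + 1)))"
          using sb[OF z(1)] by (simp only: summable_def sums_cnj) (metis complex_cnj_cnj sums_cnj)
        have h: "summable h"
          unfolding h_def by (intro summable_add sa[OF z(1)] sc)
        have total: "norm (suminf h) \<le> 1"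
          using bd[OF z(1)] unfolding h_def suminf_add[OF sa[OF z(1)] sc] .
        have hg: "norm (h k) \<le> g k" for k
          unfolding h_def g_def
          by (rule order.trans[OF norm_triangle_ineq]) (simp add: norm_mult norm_power z(2))
        have "norm (\<Sum>k. h (k + n)) \<le> T n"
          unfolding T_def
          by (rule norm_suminf_le) (use hg g in \<open>auto simp: summable_iff_shift\<close>)
        moreover have "(\<Sum>k<n. h k) = suminf h - (\<Sum>k. h (k + n))"
          using suminf_split_initial_segment[OF h, of n] by simp
        ultimately have "norm (\<Sum>k<n. h k) \<le> 1 + T n"
          using norm_triangle_ineq4[of "suminf h" "\<Sum>k. h (k + n)"] total by simp
        then show ?thesis
          by (simp add: h_def z_def power_mult_distrib mult_ac)
      qed
      from odd_trig_polynomial_square_sum_le[OF this]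
      show ?thesis
        using s by (simp add: norm_mult norm_power power_mult_distrib distrib_right)
    qed
    have "(\<lambda>n. (1 + T n)\<^sup>2) \<longlonglongrightarrow> (1 + 0)\<^sup>2"
      by (intro tendsto_intros T)
    moreover have "(\<Sum>k<N. ((norm (\<alpha> k))\<^sup>2 + (norm (\<beta> k))\<^sup>2) * (s ^ (2 * k + 1))\<^sup>2) \<le> (1 + T n)\<^sup>2"
      if "n \<ge> N" for n
      by (rule order.trans[OF sum_mono2 trunc[of n]]) (use that in auto)
    ultimately show ?thesis
      by (intro LIMSEQ_le_const) auto
  qed
  have "((\<lambda>s::real. \<Sum>k<N. ((norm (\<alpha> k))\<^sup>2 + (norm (\<beta> k))\<^sup>2) * (s ^ (2 * k + 1))\<^sup>2) \<longlongrightarrow>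
      (\<Sum>k<N. ((norm (\<alpha> k))\<^sup>2 + (norm (\<beta> k))\<^sup>2) * (1 ^ (2 * k + 1))\<^sup>2)) (at_left 1)"
    by (intro tendsto_intros)
  moreover have "\<forall>\<^sub>F s::real in at_left 1.
      (\<Sum>k<N. ((norm (\<alpha> k))\<^sup>2 + (norm (\<beta> k))\<^sup>2) * (s ^ (2 * k + 1))\<^sup>2) \<le> 1"
    by (rule eventually_mono[OF eventually_at_left_real[OF zero_less_one]]) (intro circle; simp)
  ultimately have "(\<Sum>k<N. ((norm (\<alpha> k))\<^sup>2 + (norm (\<beta> k))\<^sup>2) * (1 ^ (2 * k + 1))\<^sup>2) \<le> 1"
    by (rule tendsto_upperbound) simp
  then show ?thesis by simp
qed

section \<open>Comparison of p-norms on the plane\<close>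

text \<open>Normalising the Euclidean norm to one makes both entries at most one, and powers of
  such numbers decrease in the exponent.\<close>

lemma p_norm_le_euclidean_norm:
  fixes x y p :: real
  assumes xy: "0 \<le> x" "0 \<le> y" and p: "2 \<le> p"
  shows "(x powr p + y powr p) powr (1 / p) \<le> sqrt (x\<^sup>2 + y\<^sup>2)"
proof (cases "x = 0 \<and> y = 0")
  case True
  then show ?thesis by simp
next
  case False
  define s where "s = sqrt (x\<^sup>2 + y\<^sup>2)"
  have s: "s > 0" using False by (auto simp: s_def sum_power2_gt_zero_iff)
  have s2: "s\<^sup>2 = x\<^sup>2 + y\<^sup>2" by (simp add: s_def)
  have le: "t powr p \<le> s powr p * (t\<^sup>2 / s\<^sup>2)" if t: "0 \<le> t" "t \<le> s" for t
  proof -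
    have "(t / s) powr p \<le> (t / s) powr 2"
      using t s p by (intro powr_mono') auto
    also have "\<dots> = t\<^sup>2 / s\<^sup>2"
      using t s by (cases "t = 0") (auto simp: powr_numeral power_divide)
    finally have "s powr p * (t / s) powr p \<le> s powr p * (t\<^sup>2 / s\<^sup>2)"
      by (intro mult_left_mono) auto
    then show ?thesis using t s by (simp add: powr_divide)
  qed
  have "x \<le> s" "y \<le> s"
    using xy by (auto simp: s_def intro!: real_le_rsqrt)
  then have "x powr p + y powr p \<le> s powr p * (x\<^sup>2 / s\<^sup>2) + s powr p * (y\<^sup>2 / s\<^sup>2)"
    using xy by (intro add_mono le)
  also have "\<dots> = s powr p * ((x\<^sup>2 + y\<^sup>2) / s\<^sup>2)"
    by (simp add: add_divide_distrib distrib_left)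
  also have "\<dots> = s powr p" using s by (simp flip: s2)
  finally have "(x powr p + y powr p) powr (1 / p) \<le> (s powr p) powr (1 / p)"
    using p by (intro powr_mono2) auto
  also have "\<dots> = s" using p s by (simp add: powr_powr)
  finally show ?thesis by (simp add: s_def)
qed

text \<open>
  By Young's inequality \<open>t\<^sup>q \<le> q t + 1 - q\<close> with \<open>q = p / 2 \<le> 1\<close>. Applied to \<open>x\<^sup>2\<close> and \<open>y\<^sup>2\<close>
  divided by their mean, the linear terms cancel in the sum.
\<close>

lemma p_norm_le_scaled_euclidean_norm:
  fixes x y p :: real
  assumes xy: "0 \<le> x" "0 \<le> y" and p: "0 < p" "p \<le> 2"
  shows "(x powr p + y powr p) powr (1 / p) \<le> 2 powr (1 / p - 1 / 2) * sqrt (x\<^sup>2 + y\<^sup>2)"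
proof (cases "x = 0 \<and> y = 0")
  case True
  then show ?thesis by simp
next
  case False
  define m where "m = (x\<^sup>2 + y\<^sup>2) / 2"
  have m: "m > 0" using False by (auto simp: m_def sum_power2_gt_zero_iff)
  define q where "q = p / 2"
  have q: "0 < q" "q \<le> 1" using p by (auto simp: q_def)
  have le: "t powr p \<le> m powr q * (q * (t\<^sup>2 / m) + (1 - q))" if t: "0 \<le> t" for t
  proof (cases "t = 0")
    case True
    then show ?thesis using q by simp
  next
    case False
    then have t: "t > 0" using t by simp
    have "(t\<^sup>2 / m) powr q * 1 powr (1 - q) \<le> q * (t\<^sup>2 / m) + (1 - q) * 1"
      using q t m by (intro Youngs_inequality_0) auto
    then have "m powr q * (t\<^sup>2 / m) powr q \<le> m powr q * (q * (t\<^sup>2 / m) + (1 - q))"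
      by (intro mult_left_mono) auto
    moreover have "m powr q * (t\<^sup>2 / m) powr q = t powr p"
    proof -
      have "(t\<^sup>2) powr q = (t powr 2) powr q" using t by (simp add: powr_numeral)
      also have "\<dots> = t powr p" by (simp add: powr_powr q_def)
      finally show ?thesis using t m by (simp add: powr_divide)
    qed
    ultimately show ?thesis by simp
  qed
  have "x powr p + y powr p
      \<le> m powr q * (q * (x\<^sup>2 / m) + (1 - q)) + m powr q * (q * (y\<^sup>2 / m) + (1 - q))"
    using xy by (intro add_mono le)
  also have "\<dots> = m powr q * (q * ((x\<^sup>2 + y\<^sup>2) / m) + 2 * (1 - q))"
    by (simp add: add_divide_distrib algebra_simps)
  also have "x\<^sup>2 + y\<^sup>2 = 2 * m" by (simp add: m_def)
  finally have "x powr p + y powr p \<le> 2 * m powr q" using m by (simp add: algebra_simps)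
  then have "(x powr p + y powr p) powr (1 / p) \<le> (2 * m powr q) powr (1 / p)"
    using p by (intro powr_mono2) auto
  also have "\<dots> = 2 powr (1 / p) * m powr (1 / 2)"
    using p by (simp add: powr_mult powr_powr q_def)
  also have "\<dots> = 2 powr (1 / p - 1 / 2) * sqrt (x\<^sup>2 + y\<^sup>2)"
    using m by (simp add: m_def powr_divide powr_diff powr_half_sqrt real_sqrt_divide)
  finally show ?thesis .
qed

section \<open>The majorant and the radius\<close>

text \<open>Cauchy-Schwarz against the geometric series \<open>\<Sum>\<^sub>k r\<^sup>4\<^sup>k\<^sup>+\<^sup>2 = r\<^sup>2 / (1 - r\<^sup>4)\<close>, on partial sums.\<close>

lemma odd_series_le_of_square_sum_le_1:
  fixes c d :: "nat \<Rightarrow> real"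
  assumes sq: "\<And>n. (\<Sum>k<n. (c k)\<^sup>2) \<le> 1"
    and d: "\<And>k. 0 \<le> d k" "\<And>k. d k \<le> K * c k"
    and K: "0 \<le> K" and r: "0 \<le> r" "r < 1"
  shows "summable (\<lambda>k. d k * r ^ (2 * k + 1))"
    and "(\<Sum>k. d k * r ^ (2 * k + 1)) \<le> K * (r / sqrt (1 - r ^ 4))"
proof -
  have r4: "r ^ 4 < 1" using r by (simp add: power_less_one_iff)
  have geo: "(\<Sum>k<n. (r ^ (2 * k + 1))\<^sup>2) \<le> r\<^sup>2 / (1 - r ^ 4)" for n
  proof -
    have eq: "(r ^ (2 * k + 1))\<^sup>2 = r\<^sup>2 * (r ^ 4) ^ k" for k
      by (simp add: power_mult_distrib mult_ac flip: power_mult)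
    have "(\<Sum>k<n. (r ^ 4) ^ k) = (1 - (r ^ 4) ^ n) / (1 - r ^ 4)"
      using r4 by (simp add: sum_gp_strict)
    also have "\<dots> \<le> 1 / (1 - r ^ 4)"
      using r4 r by (intro divide_right_mono) auto
    finally have "r\<^sup>2 * (\<Sum>k<n. (r ^ 4) ^ k) \<le> r\<^sup>2 * (1 / (1 - r ^ 4))"
      by (intro mult_left_mono) auto
    then show ?thesis unfolding eq by (simp add: sum_distrib_left)
  qed
  have partial: "(\<Sum>k<n. d k * r ^ (2 * k + 1)) \<le> K * (r / sqrt (1 - r ^ 4))" for n
  proof -
    have "(\<Sum>k<n. c k * r ^ (2 * k + 1))\<^sup>2 \<le> (\<Sum>k<n. (c k)\<^sup>2) * (\<Sum>k<n. (r ^ (2 * k + 1))\<^sup>2)"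
      by (rule Cauchy_Schwarz_ineq_sum)
    also have "\<dots> \<le> 1 * (r\<^sup>2 / (1 - r ^ 4))"
      by (intro mult_mono sq geo sum_nonneg) auto
    finally have "(\<Sum>k<n. c k * r ^ (2 * k + 1)) \<le> sqrt (r\<^sup>2 / (1 - r ^ 4))"
      by (intro real_le_rsqrt) simp
    also have "\<dots> = r / sqrt (1 - r ^ 4)"
      using r by (simp add: real_sqrt_divide)
    finally have "K * (\<Sum>k<n. c k * r ^ (2 * k + 1)) \<le> K * (r / sqrt (1 - r ^ 4))"
      using K by (intro mult_left_mono)
    moreover have "(\<Sum>k<n. d k * r ^ (2 * k + 1)) \<le> (\<Sum>k<n. K * c k * r ^ (2 * k + 1))"
      using d r by (intro sum_mono mult_right_mono) auto
    ultimately show ?thesis by (simp add: sum_distrib_left mult_ac)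
  qed
  show summ: "summable (\<lambda>k. d k * r ^ (2 * k + 1))"
    by (rule summableI_nonneg_bounded[OF _ partial]) (use d r in auto)
  show "(\<Sum>k. d k * r ^ (2 * k + 1)) \<le> K * (r / sqrt (1 - r ^ 4))"
    by (rule suminf_le_const[OF summ partial])
qed

text \<open>
  With \<open>h = 2\<^sup>2\<^sup>/\<^sup>p\<^sup>-\<^sup>2\<close>, the number \<open>sqrt (h\<^sup>2 + 1) - h\<close> under the outer root of \<open>rho p\<close> is the positive root
  of \<open>x\<^sup>2 + 2 h x = 1\<close>, and \<open>2 h = (2\<^sup>1\<^sup>/\<^sup>p\<^sup>-\<^sup>1\<^sup>/\<^sup>2)\<^sup>2\<close>.
\<close>

lemma radius_bound:
  fixes p r :: real
  assumes r: "0 \<le> r" "r \<le> rho p"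
  shows "r < 1" and "2 powr (1 / p - 1 / 2) * (r / sqrt (1 - r ^ 4)) \<le> 1"
proof -
  define h :: real where "h = 2 powr (2 / p - 2)"
  have h: "h > 0" by (simp add: h_def)
  have "(4::real) powr (2 / p - 2) = (2 powr 2) powr (2 / p - 2)"
    by simp
  also have "\<dots> = h\<^sup>2"
    unfolding h_def powr_powr by (simp add: power2_eq_square flip: powr_add)
  finally have rho: "rho p = sqrt (sqrt (h\<^sup>2 + 1) - h)"
    by (simp add: rho_def h_def)
  have "h \<le> sqrt (h\<^sup>2 + 1)" by (intro real_le_rsqrt) simp
  moreover have "r\<^sup>2 \<le> (rho p)\<^sup>2" using r by (intro power_mono)
  ultimately have le: "r\<^sup>2 + h \<le> sqrt (h\<^sup>2 + 1)" by (simp add: rho)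
  have "(r\<^sup>2 + h)\<^sup>2 \<le> (sqrt (h\<^sup>2 + 1))\<^sup>2"
    using h by (intro power_mono le) simp
  then have quad: "r ^ 4 + 2 * h * r\<^sup>2 \<le> 1"
    by (simp add: power2_sum flip: power_mult) (simp add: mult_ac)
  show r1: "r < 1"
  proof (rule ccontr)
    assume "\<not> r < 1"
    then have "1 \<le> r ^ 4" "0 < r\<^sup>2" by (auto intro: one_le_power)
    then show False using quad mult_pos_pos[of "2 * h" "r\<^sup>2"] h by linarith
  qed
  have r4: "r ^ 4 < 1" using r r1 by (simp add: power_less_one_iff)
  have K: "(2 powr (1 / p - 1 / 2))\<^sup>2 = 2 * h"
  proof -
    have "(2 powr (1 / p - 1 / 2))\<^sup>2 = (2::real) powr (2 / p - 1)"
      by (simp add: power2_eq_square flip: powr_add)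
    also have "\<dots> = 2 powr (1 + (2 / p - 2))" by simp
    also have "\<dots> = 2 * h" by (simp only: powr_add h_def) simp
    finally show ?thesis .
  qed
  have "2 powr (1 / p - 1 / 2) * r \<le> sqrt (1 - r ^ 4)"
    by (intro real_le_rsqrt) (use quad in \<open>simp add: power_mult_distrib K\<close>)
  then show "2 powr (1 / p - 1 / 2) * (r / sqrt (1 - r ^ 4)) \<le> 1"
    using r4 by simp
qed

theorem theorem4:
  fixes f :: "complex \<Rightarrow> complex" and a b :: "nat \<Rightarrow> complex"
  assumes harmonic: "harmonic_on f (ball 0 1)"
    and odd_f: "\<And>z. z \<in> ball 0 1 \<Longrightarrow> f (- z) = - f z"
    and summable_a: "\<And>z. z \<in> ball 0 1 \<Longrightarrow> summable (\<lambda>k. a (2 * k + 1) * z ^ (2 * k + 1))"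
    and summable_b: "\<And>z. z \<in> ball 0 1 \<Longrightarrow> summable (\<lambda>k. b (2 * k + 1) * z ^ (2 * k + 1))"
    and f_eq: "\<And>z. z \<in> ball 0 1 \<Longrightarrow>
      f z = (\<Sum>k. a (2 * k + 1) * z ^ (2 * k + 1)) + (\<Sum>k. cnj (b (2 * k + 1) * z ^ (2 * k + 1)))"
    and bound: "\<And>z. z \<in> ball 0 1 \<Longrightarrow> norm (f z) < 1"
  shows "(\<forall>p r :: real. 1 \<le> p \<longrightarrow> p \<le> 2 \<longrightarrow> 0 \<le> r \<longrightarrow> r \<le> rho p \<longrightarrow>
      summable (\<lambda>k. (norm (a (2 * k + 1)) powr p + norm (b (2 * k + 1)) powr p) powr (1 / p) * r ^ (2 * k + 1)) \<and>
      (\<Sum>k. (norm (a (2 * k + 1)) powr p + norm (b (2 * k + 1)) powr p) powr (1 / p) * r ^ (2 * k + 1))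
        \<le> 2 powr (1 / p - 1 / 2) * (r / sqrt (1 - r ^ 4)) \<and>
      2 powr (1 / p - 1 / 2) * (r / sqrt (1 - r ^ 4)) \<le> 1) \<and>
    rho 2 = sqrt ((sqrt 5 - 1) / 2) \<and>
    (\<forall>p r :: real. 2 \<le> p \<longrightarrow> 0 \<le> r \<longrightarrow> r \<le> rho 2 \<longrightarrow>
      summable (\<lambda>k. (norm (a (2 * k + 1)) powr p + norm (b (2 * k + 1)) powr p) powr (1 / p) * r ^ (2 * k + 1)) \<and>
      (\<Sum>k. (norm (a (2 * k + 1)) powr p + norm (b (2 * k + 1)) powr p) powr (1 / p) * r ^ (2 * k + 1))
        \<le> r / sqrt (1 - r ^ 4) \<and>
      r / sqrt (1 - r ^ 4) \<le> 1)"
proof -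
  define c where "c k = sqrt ((norm (a (2 * k + 1)))\<^sup>2 + (norm (b (2 * k + 1)))\<^sup>2)" for k
  have sq: "(\<Sum>k<n. (c k)\<^sup>2) \<le> 1" for n
    using coefficient_square_sum_le_1[of "\<lambda>k. a (2 * k + 1)" "\<lambda>k. b (2 * k + 1)" n,
        OF summable_a summable_b] bound
    by (simp add: c_def f_eq less_imp_le)
  have small_p: "summable (\<lambda>k. (norm (a (2 * k + 1)) powr p + norm (b (2 * k + 1)) powr p) powr (1 / p) * r ^ (2 * k + 1)) \<and>
      (\<Sum>k. (norm (a (2 * k + 1)) powr p + norm (b (2 * k + 1)) powr p) powr (1 / p) * r ^ (2 * k + 1))
        \<le> 2 powr (1 / p - 1 / 2) * (r / sqrt (1 - r ^ 4)) \<and>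
      2 powr (1 / p - 1 / 2) * (r / sqrt (1 - r ^ 4)) \<le> 1"
    if p: "1 \<le> p" "p \<le> 2" and r: "0 \<le> r" "r \<le> rho p" for p r :: real
  proof -
    have "(norm (a (2 * k + 1)) powr p + norm (b (2 * k + 1)) powr p) powr (1 / p)
        \<le> 2 powr (1 / p - 1 / 2) * c k" for k
      unfolding c_def using p by (intro p_norm_le_scaled_euclidean_norm) auto
    note series = odd_series_le_of_square_sum_le_1[OF sq _ this _ r(1) radius_bound(1)[OF r]]
    show ?thesis
      using series radius_bound(2)[OF r] by simp
  qed
  have rho_2: "rho 2 = sqrt ((sqrt 5 - 1) / 2)"
  proof -
    have "(4::real) powr (- 1) + 1 = 5 / 4" "(2::real) powr (- 1) = 1 / 2"
      by (simp_all add: powr_minus)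
    then show ?thesis by (simp add: rho_def real_sqrt_divide diff_divide_distrib)
  qed
  have large_p: "summable (\<lambda>k. (norm (a (2 * k + 1)) powr p + norm (b (2 * k + 1)) powr p) powr (1 / p) * r ^ (2 * k + 1)) \<and>
      (\<Sum>k. (norm (a (2 * k + 1)) powr p + norm (b (2 * k + 1)) powr p) powr (1 / p) * r ^ (2 * k + 1))
        \<le> r / sqrt (1 - r ^ 4) \<and>
      r / sqrt (1 - r ^ 4) \<le> 1"
    if p: "2 \<le> p" and r: "0 \<le> r" "r \<le> rho 2" for p r :: real
  proof -
    have "(norm (a (2 * k + 1)) powr p + norm (b (2 * k + 1)) powr p) powr (1 / p) \<le> 1 * c k" for k
      unfolding c_def using p by (simp add: p_norm_le_euclidean_norm)
    note series = odd_series_le_of_square_sum_le_1[OF sq _ this _ r(1) radius_bound(1)[OF r]]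
    show ?thesis
      using series radius_bound(2)[OF r] by simp
  qed
  show ?thesis
    using small_p rho_2 large_p by blast
qed

end
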